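(* Let $d\geq1$, let $\alpha_1,\ldots,\alpha_d>0$ with $2\sum_{i=1}^d\alpha_i=1$, let $0<c<\min\{\alpha_1,\ldots,\alpha_d\}$, and let $M\geq0$ be an integer. For each $i$ let $\tilde\alpha_i,\tilde\beta_i:\mathbb{Z}\to[c,\infty)$ satisfy $\tilde\alpha_i(x)+\tilde\beta_i(x)\leq2\alpha_i$ and $\tilde\alpha_i(x)=\tilde\beta_i(-x)$ for all $x\in\mathbb{Z}$, and $\tilde\alpha_i(x)=\tilde\beta_i(x)=\alpha_i$ whenever $|x|>M$. Let $\mathbf{S}_t$ be the random walk in $\mathbb{Z}^d$ with $\mathbf{S}_0=\mathbf{0}$, $\mathbf{S}_t=\mathbf{S}_{t-1}+\mathbf{e}_t$, where, given the past, $\mathbf{e}_t=\mathbf{1}_i$ with probability $\tilde\alpha_i(S^{(i)}_{t-1})$, $\mathbf{e}_t=-\mathbf{1}_i$ with probability $\tilde\beta_i(S^{(i)}_{t-1})$ ($i=1,\ldots,d$), and $\mathbf{e}_t=\mathbf{0}$ with probability $1-\sum_{i=1}^d[\tilde\alpha_i(S^{(i)}_{t-1})+\tilde\beta_i(S^{(i)}_{t-1})]$. Then $\mathbf{S}_t$ is recurrent if $d\leq2$ and transient if $d\geq3$.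
   Context: $\mathbf{1}_i$ is the $i$th unit vector of $\mathbb{Z}^d$ and $S^{(i)}_t$ the $i$th coordinate of $\mathbf{S}_t$. Recurrent means that the walk returns to the origin infinitely many times with probability one; transient means it is not recurrent. *)

theory Defs
  imports "HOL-Probability.Probability"
begin

text \<open>Points of Z^d are represented as functions nat => int whose coordinates
  with index >= d are irrelevant (they stay 0 along the walk started at the origin).\<close>

definition origin :: "nat \<Rightarrow> int" where
  "origin = (\<lambda>_. 0)"

definition rw_trans :: "nat \<Rightarrow> (nat \<Rightarrow> int \<Rightarrow> real) \<Rightarrow> (nat \<Rightarrow> int \<Rightarrow> real)
    \<Rightarrow> (nat \<Rightarrow> int) \<Rightarrow> (nat \<Rightarrow> int) \<Rightarrow> real" where
  "rw_trans d a b x y =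
     (\<Sum>i<d. (if y = x(i := x i + 1) then a i (x i) else 0)
            + (if y = x(i := x i - 1) then b i (x i) else 0))
     + (if y = x then 1 - (\<Sum>i<d. a i (x i) + b i (x i)) else 0)"

definition is_walk :: "'w measure \<Rightarrow> (nat \<Rightarrow> 'w \<Rightarrow> (nat \<Rightarrow> int)) \<Rightarrow> nat
    \<Rightarrow> (nat \<Rightarrow> int \<Rightarrow> real) \<Rightarrow> (nat \<Rightarrow> int \<Rightarrow> real) \<Rightarrow> bool" where
  "is_walk M S d a b \<longleftrightarrow>
     prob_space M \<and>
     (\<forall>t. S t \<in> measurable M (count_space UNIV)) \<and>
     (\<forall>t xs. measure M {\<omega> \<in> space M. \<forall>k\<le>t. S k \<omega> = xs k}
        = (if xs 0 = origin then 1 else 0) * (\<Prod>k<t. rw_trans d a b (xs k) (xs (Suc k))))"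

definition recurrent :: "'w measure \<Rightarrow> (nat \<Rightarrow> 'w \<Rightarrow> (nat \<Rightarrow> int)) \<Rightarrow> bool" where
  "recurrent M S \<longleftrightarrow> (AE \<omega> in M. infinite {t. S t \<omega> = origin})"

definition transient :: "'w measure \<Rightarrow> (nat \<Rightarrow> 'w \<Rightarrow> (nat \<Rightarrow> int)) \<Rightarrow> bool" where
  "transient M S \<longleftrightarrow> \<not> recurrent M S"

end

theory Submission
  imports Defs
begin

text \<open>The symmetry of the coefficients makes the walk reversible with respect to a product measure
  that is bounded above and below, so its Dirichlet form is comparable with that of the simple
  random walk on the lattice. The truncated Green function \<open>g\<close> of the origin is finitely supported
  and has energy at most \<open>w(0) g(0)\<close>. In dimension at least three the Polya urn defines a flow of
  finite energy from the origin to infinity, so that \<open>g(0)\<close> is controlled by the square root of the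
  energy of \<open>g\<close> and stays bounded; the Borel-Cantelli lemma then gives transience. In dimension at
  most two, logarithmic cutoff functions show that the origin has capacity zero, so the Green
  function diverges, and a decomposition according to the last visit gives recurrence.\<close>

subsection \<open>Finitely supported functions and the Dirichlet form\<close>

text \<open>The site-dependent rates break translation invariance, so return probabilities cannot be
  read off from Fourier analysis; energies only call for two-sided bounds on the conductances
  \<open>w x * a i (x i)\<close>. The rates in direction \<open>i\<close> depend on coordinate
  \<open>i\<close> alone, so a product of one-dimensional reversing weights balances every edge, and
  rests contribute no energy. Truncating the Green function and testing with finitely supported
  functions makes every infinite sum effectively finite. The price is the error
  \<open>heat N\<close>: in the energy of \<open>green N\<close> its sign is favourable, and against
  a fixed test function it tends to zero once the Green function is assumed to converge. Young's
  inequality with a free parameter replaces Cauchy-Schwarz; it avoids square roots and lets the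
  value at the origin be absorbed into itself.\<close>

definition up :: "nat \<Rightarrow> (nat \<Rightarrow> int) \<Rightarrow> nat \<Rightarrow> int" where
  "up i x = x(i := x i + 1)"

definition down :: "nat \<Rightarrow> (nat \<Rightarrow> int) \<Rightarrow> nat \<Rightarrow> int" where
  "down i x = x(i := x i - 1)"

lemma up_down [simp]: "up i (down i x) = x" and down_up [simp]: "down i (up i x) = x"
  by (auto simp: up_def down_def)

lemma bij_up: "bij (up i)"
  by (rule bij_betw_byWitness[where f' = "down i"]) auto

lemma bij_down: "bij (down i)"
  by (rule bij_betw_byWitness[where f' = "up i"]) auto

lemma up_apply_same [simp]: "up i x i = x i + 1"
  by (simp add: up_def)

definition finsupp :: "('a \<Rightarrow> real) \<Rightarrow> bool" where
  "finsupp f \<longleftrightarrow> finite {x. f x \<noteq> 0}"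

lemma finsupp_mono: "finsupp f \<Longrightarrow> (\<And>x. f x = 0 \<Longrightarrow> g x = 0) \<Longrightarrow> finsupp g"
  unfolding finsupp_def by (erule rev_finite_subset) auto

lemma finsupp_add: "finsupp f \<Longrightarrow> finsupp g \<Longrightarrow> finsupp (\<lambda>x. f x + g x)"
  unfolding finsupp_def
  by (rule finite_subset[of _ "{x. f x \<noteq> 0} \<union> {x. g x \<noteq> 0}"]) auto

lemma finsupp_diff: "finsupp f \<Longrightarrow> finsupp g \<Longrightarrow> finsupp (\<lambda>x. f x - g x)"
  unfolding finsupp_def
  by (rule finite_subset[of _ "{x. f x \<noteq> 0} \<union> {x. g x \<noteq> 0}"]) auto

lemma finsupp_sum: "(\<And>i. i \<in> I \<Longrightarrow> finsupp (f i)) \<Longrightarrow> finsupp (\<lambda>x. \<Sum>i\<in>I. f i x)"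
  by (induction I rule: infinite_finite_induct) (auto intro: finsupp_add simp: finsupp_def[of "\<lambda>_. 0"])

lemma finsupp_mult_left: "finsupp f \<Longrightarrow> finsupp (\<lambda>x. f x * g x)"
  by (erule finsupp_mono) auto

lemma finsupp_mult_right: "finsupp f \<Longrightarrow> finsupp (\<lambda>x. g x * f x)"
  by (erule finsupp_mono) auto

lemma finsupp_comp_bij: "finsupp f \<Longrightarrow> bij h \<Longrightarrow> finsupp (\<lambda>x. f (h x))"
  unfolding finsupp_def using finite_vimageI[of "{x. f x \<noteq> 0}" h]
  by (auto simp: bij_def vimage_def)

lemma finsupp_up: "finsupp f \<Longrightarrow> finsupp (\<lambda>x. f (up i x))"
  by (rule finsupp_comp_bij[OF _ bij_up])

lemma finsupp_down: "finsupp f \<Longrightarrow> finsupp (\<lambda>x. f (down i x))"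
  by (rule finsupp_comp_bij[OF _ bij_down])

lemma finsupp_indicator: "finite A \<Longrightarrow> finsupp (indicat_real A)"
  unfolding finsupp_def by (simp add: indicator_def)

lemma finsupp_summable: "finsupp f \<Longrightarrow> f summable_on A"
  unfolding finsupp_def
  by (rule finite_nonzero_values_imp_summable_on) (erule rev_finite_subset, auto)

lemma infsum_add_finsupp:
  "finsupp f \<Longrightarrow> finsupp g \<Longrightarrow> (\<Sum>\<^sub>\<infinity>x. f x + g x) = (\<Sum>\<^sub>\<infinity>x. f x) + (\<Sum>\<^sub>\<infinity>x. g x)"
  by (intro infsum_add finsupp_summable)

lemma infsum_diff_finsupp:
  assumes "finsupp f" "finsupp g"
  shows "(\<Sum>\<^sub>\<infinity>x. f x - g x) = (\<Sum>\<^sub>\<infinity>x. f x) - (\<Sum>\<^sub>\<infinity>x. g x)"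
  using infsum_add_finsupp[OF finsupp_diff[OF assms] assms(2)] by simp

lemma infsum_sum_finsupp:
  "(\<And>i. i \<in> I \<Longrightarrow> finsupp (f i)) \<Longrightarrow> (\<Sum>\<^sub>\<infinity>x. \<Sum>i\<in>I. f i x) = (\<Sum>i\<in>I. \<Sum>\<^sub>\<infinity>x. f i x)"
  by (induction I rule: infinite_finite_induct) (auto simp: infsum_add_finsupp finsupp_sum)

section \<open>Transition operator, heat kernel and truncated Green function\<close>

locale walk_kernel =
  fixes d :: nat and a b :: "nat \<Rightarrow> int \<Rightarrow> real"
  assumes a_nonneg: "i < d \<Longrightarrow> 0 \<le> a i z"
    and b_nonneg: "i < d \<Longrightarrow> 0 \<le> b i z"
    and total_le_1: "(\<Sum>i<d. a i (x i) + b i (x i)) \<le> 1"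
begin

definition Pop :: "((nat \<Rightarrow> int) \<Rightarrow> real) \<Rightarrow> (nat \<Rightarrow> int) \<Rightarrow> real" where
  "Pop f x = (\<Sum>i<d. a i (x i) * f (up i x) + b i (x i) * f (down i x))
     + (1 - (\<Sum>i<d. a i (x i) + b i (x i))) * f x"

lemma Pop_laplace:
  "f x - Pop f x = (\<Sum>i<d. a i (x i) * (f x - f (up i x)) + b i (x i) * (f x - f (down i x)))"
  by (simp add: Pop_def algebra_simps sum.distrib sum_subtractf sum_distrib_left)

lemma Pop_nonneg: "(\<And>x. 0 \<le> f x) \<Longrightarrow> 0 \<le> Pop f x"
  unfolding Pop_def using total_le_1[of x]
  by (intro add_nonneg_nonneg sum_nonneg mult_nonneg_nonneg) (auto simp: a_nonneg b_nonneg)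

lemma Pop_const [simp]: "Pop (\<lambda>_. k) = (\<lambda>_. k)"
  by (rule ext) (simp add: Pop_def algebra_simps sum.distrib sum_distrib_left)

lemma Pop_add: "Pop (\<lambda>x. f x + g x) x = Pop f x + Pop g x"
  by (simp add: Pop_def algebra_simps sum.distrib)

lemma Pop_cmult: "Pop (\<lambda>x. k * f x) x = k * Pop f x"
  by (simp add: Pop_def algebra_simps sum.distrib sum_distrib_left)

lemma Pop_sum: "Pop (\<lambda>x. \<Sum>n<N. f n x) x = (\<Sum>n<(N::nat). Pop (f n) x)"
  by (induction N) (simp_all add: Pop_add)

lemma finsupp_Pop: "finsupp f \<Longrightarrow> finsupp (Pop f)"
  unfolding Pop_def[abs_def]
  by (intro finsupp_add finsupp_sum finsupp_mult_right finsupp_up finsupp_down)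

text \<open>Iterating the operator on functions fixes the target and varies the start:
  \<open>heat n x\<close> is the probability of being at the origin after \<open>n\<close> steps
  from \<open>x\<close>.\<close>

definition heat :: "nat \<Rightarrow> (nat \<Rightarrow> int) \<Rightarrow> real" where
  "heat n = (Pop ^^ n) (indicat_real {origin})"

lemma heat_0: "heat 0 = indicat_real {origin}" and heat_Suc: "heat (Suc n) = Pop (heat n)"
  by (simp_all add: heat_def)

lemma heat_nonneg: "0 \<le> heat n x"
  by (induction n arbitrary: x) (auto simp: heat_0 heat_Suc intro: Pop_nonneg)

lemma finsupp_heat: "finsupp (heat n)"
  by (induction n) (auto simp: heat_0 heat_Suc intro: finsupp_Pop finsupp_indicator)

definition green :: "nat \<Rightarrow> (nat \<Rightarrow> int) \<Rightarrow> real" where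
  "green N x = (\<Sum>n<N. heat n x)"

lemma green_nonneg: "0 \<le> green N x"
  unfolding green_def by (intro sum_nonneg heat_nonneg)

lemma finsupp_green: "finsupp (green N)"
  unfolding green_def[abs_def] by (intro finsupp_sum finsupp_heat)

lemma green_laplace: "green N x - Pop (green N) x = heat 0 x - heat N x"
proof -
  have "Pop (green N) x = (\<Sum>n<N. heat (Suc n) x)"
    unfolding green_def[abs_def] Pop_sum by (simp add: heat_Suc)
  then show ?thesis
    unfolding green_def
    by (simp add: sum_lessThan_telescope'[of "\<lambda>n. heat n x", symmetric] sum_subtractf)
qed

end

section \<open>Reversibility, summation by parts and energy estimates\<close>

locale reversible_walk = walk_kernel +
  fixes w :: "(nat \<Rightarrow> int) \<Rightarrow> real"
  assumes w_pos: "0 < w x"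
    and balance: "i < d \<Longrightarrow> w x * a i (x i) = w (up i x) * b i (x i + 1)"
begin

definition ip :: "((nat \<Rightarrow> int) \<Rightarrow> real) \<Rightarrow> ((nat \<Rightarrow> int) \<Rightarrow> real) \<Rightarrow> real" where
  "ip f g = (\<Sum>\<^sub>\<infinity>x. w x * f x * g x)"

text \<open>Each undirected edge is counted once, from its lower endpoint, so the usual factor 1/2
  of the Dirichlet form is absent.\<close>

definition form :: "((nat \<Rightarrow> int) \<Rightarrow> real) \<Rightarrow> ((nat \<Rightarrow> int) \<Rightarrow> real) \<Rightarrow> real" where
  "form f g = (\<Sum>i<d. \<Sum>\<^sub>\<infinity>x. w x * a i (x i) * (f (up i x) - f x) * (g (up i x) - g x))"

lemma ip_commute: "ip f g = ip g f"
  by (simp add: ip_def mult_ac)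

lemma form_commute: "form f g = form g f"
  by (simp add: form_def mult_ac)

lemma ip_diff_right: "finsupp f \<Longrightarrow> ip f (\<lambda>x. g x - h x) = ip f g - ip f h"
  unfolding ip_def right_diff_distrib
  by (intro infsum_diff_finsupp finsupp_mult_left finsupp_mult_right)

lemma ip_indicator: "ip (indicat_real {origin}) f = w origin * f origin"
proof -
  have "ip (indicat_real {origin}) f = (\<Sum>\<^sub>\<infinity>x\<in>{origin}. w x * f x)"
    unfolding ip_def by (rule infsum_cong_neutral) (auto simp: indicator_def)
  then show ?thesis by simp
qed

lemma ip_nonneg: "(\<And>x. 0 \<le> f x) \<Longrightarrow> (\<And>x. 0 \<le> g x) \<Longrightarrow> 0 \<le> ip f g"
  unfolding ip_def using w_pos by (intro infsum_nonneg mult_nonneg_nonneg) (auto intro: less_imp_le)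

text \<open>Summation by parts: the contribution of the steps \<open>x \<rightarrow> down i x\<close> is moved to the
  edge starting at \<open>down i x\<close> and absorbed there by detailed balance.\<close>

lemma ip_laplace:
  assumes f: "finsupp f" and g: "finsupp g"
  shows "ip f (\<lambda>x. g x - Pop g x) = form f g"
proof -
  let ?u = "\<lambda>i x. w x * a i (x i) * f x * (g x - g (up i x))"
  let ?v = "\<lambda>i x. w x * b i (x i) * f x * (g x - g (down i x))"
  let ?v' = "\<lambda>i x. w x * a i (x i) * f (up i x) * (g (up i x) - g x)"
  have fs: "finsupp (?u i)" "finsupp (?v i)" for i
    by (rule finsupp_mono[OF f]; simp)+
  have fs': "finsupp (?v' i)" for i
    by (rule finsupp_mono[OF finsupp_up[of f i, OF f]]) simp
  have v: "(\<Sum>\<^sub>\<infinity>x. ?v i x) = (\<Sum>\<^sub>\<infinity>x. ?v' i x)" if "i < d" for i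
  proof -
    have "(\<Sum>\<^sub>\<infinity>x. ?v i (up i x)) = (\<Sum>\<^sub>\<infinity>x. ?v i x)"
      by (rule infsum_reindex_bij_betw[OF bij_up])
    then show ?thesis using balance[OF that] by simp
  qed
  have "ip f (\<lambda>x. g x - Pop g x) = (\<Sum>\<^sub>\<infinity>x. \<Sum>i<d. ?u i x + ?v i x)"
    unfolding ip_def Pop_laplace by (simp add: sum_distrib_left algebra_simps)
  also have "\<dots> = (\<Sum>i<d. (\<Sum>\<^sub>\<infinity>x. ?u i x) + (\<Sum>\<^sub>\<infinity>x. ?v i x))"
    by (simp add: infsum_sum_finsupp infsum_add_finsupp fs finsupp_add)
  also have "\<dots> = (\<Sum>i<d. \<Sum>\<^sub>\<infinity>x. ?u i x + ?v' i x)"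
    using v by (intro sum.cong) (simp_all add: infsum_add_finsupp fs fs')
  also have "\<dots> = form f g"
    unfolding form_def by (intro sum.cong infsum_cong) (auto simp: algebra_simps)
  finally show ?thesis .
qed

lemma Pop_selfadjoint:
  assumes "finsupp f" "finsupp g"
  shows "ip f (Pop g) = ip (Pop f) g"
proof -
  have "ip f g - ip f (Pop g) = ip g f - ip g (Pop f)"
    using ip_laplace[OF assms] ip_laplace[OF assms(2,1)] form_commute[of f g]
    by (simp add: ip_diff_right assms)
  then show ?thesis by (simp add: ip_commute)
qed

text \<open>Self-adjointness carries the \<open>m\<close> steps one by one to the other argument,
  until a point mass is left. The case \<open>m = n\<close> later controls off-diagonal values by
  returns at even times.\<close>

lemma ip_heat: "ip (heat m) (heat n) = w origin * heat (m + n) origin"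
proof (induction m arbitrary: n)
  case 0
  then show ?case by (simp add: heat_0 ip_indicator)
next
  case (Suc m)
  have "ip (heat (Suc m)) (heat n) = ip (heat m) (heat (Suc n))"
    by (simp add: heat_Suc Pop_selfadjoint finsupp_heat)
  then show ?case by (simp add: Suc.IH)
qed

lemma form_self_term_nonneg: "i < d \<Longrightarrow> 0 \<le> w x * a i (x i) * (f (up i x) - f x) * (f (up i x) - f x)"
  using w_pos[of x] a_nonneg[of i "x i"] by (simp add: mult.assoc)

text \<open>The Laplacian of \<open>green N\<close> is the point mass at the origin minus
  \<open>heat N\<close>. Both \<open>green N\<close> and \<open>heat N\<close> are nonnegative, so
  the truncation term can only lower the energy.\<close>

lemma form_green_le: "form (green N) (green N) \<le> w origin * green N origin"
proof -
  have "form (green N) (green N) = ip (green N) (\<lambda>x. heat 0 x - heat N x)"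
    using ip_laplace[OF finsupp_green finsupp_green, of N N] by (simp add: green_laplace)
  also have "\<dots> = w origin * green N origin - ip (green N) (heat N)"
    by (simp add: ip_diff_right finsupp_green heat_0 ip_commute[of "green N" "indicat_real _"] ip_indicator)
  also have "\<dots> \<le> w origin * green N origin"
    using ip_nonneg[of "green N" "heat N"] green_nonneg heat_nonneg by simp
  finally show ?thesis .
qed

text \<open>Cauchy-Schwarz in parametric form: on each edge with increments \<open>p\<close> and
  \<open>q\<close> it is the expansion of \<open>(k * p - q)\<^sup>2 / k\<close>, which is
  nonnegative.\<close>

lemma form_le_young:
  assumes f: "finsupp f" and g: "finsupp g" and k: "0 < k"
  shows "2 * form f g \<le> k * form f f + form g g / k"
proof -
  let ?T = "\<lambda>f g i x. w x * a i (x i) * (f (up i x) - f x) * (g (up i x) - g x)"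
  have fs: "finsupp (?T f g i)" if "finsupp f" for f g i
    by (rule finsupp_mono[OF finsupp_diff[OF finsupp_up[of f i, OF that] that]]) simp
  have "2 * (\<Sum>\<^sub>\<infinity>x. ?T f g i x) \<le> k * (\<Sum>\<^sub>\<infinity>x. ?T f f i x) + (\<Sum>\<^sub>\<infinity>x. ?T g g i x) / k" if i: "i < d" for i
  proof -
    have ineq: "2 * ?T f g i x \<le> k * ?T f f i x + 1 / k * ?T g g i x" for x
    proof -
      let ?p = "f (up i x) - f x" and ?q = "g (up i x) - g x"
      have "0 \<le> w x * a i (x i) * ((k * ?p - ?q)\<^sup>2 / k)"
        using w_pos[of x] a_nonneg[OF i] k by (simp add: less_imp_le)
      also have "\<dots> = k * ?T f f i x + 1 / k * ?T g g i x - 2 * ?T f g i x"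
        using k by (simp add: field_simps power2_eq_square)
      finally show ?thesis by simp
    qed
    have "(\<Sum>\<^sub>\<infinity>x. 2 * ?T f g i x) \<le> (\<Sum>\<^sub>\<infinity>x. k * ?T f f i x + 1 / k * ?T g g i x)"
      by (intro infsum_mono finsupp_summable finsupp_add finsupp_mult_right fs f g ineq)
    also have "\<dots> = (\<Sum>\<^sub>\<infinity>x. k * ?T f f i x) + (\<Sum>\<^sub>\<infinity>x. 1 / k * ?T g g i x)"
      by (intro infsum_add_finsupp finsupp_mult_right fs f g)
    finally show ?thesis
      by (simp only: infsum_cmult_right') simp
  qed
  then have "(\<Sum>i<d. 2 * (\<Sum>\<^sub>\<infinity>x. ?T f g i x))
      \<le> (\<Sum>i<d. k * (\<Sum>\<^sub>\<infinity>x. ?T f f i x) + (\<Sum>\<^sub>\<infinity>x. ?T g g i x) / k)"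
    by (intro sum_mono) auto
  then show ?thesis
    by (simp add: form_def sum_distrib_left sum.distrib sum_divide_distrib)
qed

end

subsection \<open>Path probabilities\<close>

text \<open>The state space \<open>nat \<Rightarrow> int\<close> is uncountable, so an event cannot
  be split over all values of the next state. Finitely many disjoint pieces that carry the whole
  mass of \<open>D\<close> suffice, since what they miss is a null set.\<close>

lemma (in finite_measure) measure_split_finite:
  assumes "finite I" "disjoint_family_on B I" "\<And>y. y \<in> I \<Longrightarrow> B y \<in> sets M"
    and "D \<in> sets M" "E \<in> sets M" "E \<subseteq> D" "\<And>y. y \<in> I \<Longrightarrow> B y \<subseteq> D"
    and "measure M D = (\<Sum>y\<in>I. measure M (B y))"
  shows "measure M E = (\<Sum>y\<in>I. measure M (E \<inter> B y))"
proof -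
  let ?U = "\<Union>y\<in>I. B y"
  have U: "?U \<in> sets M" "?U \<subseteq> D" using assms by auto
  have "measure M ?U = measure M D"
    using assms by (subst finite_measure_finite_Union) auto
  then have "measure M (D - ?U) = 0"
    using finite_measure_Diff[OF assms(4) U] by simp
  moreover have "measure M (E - ?U) \<le> measure M (D - ?U)"
    using assms U by (intro finite_measure_mono) auto
  ultimately have "measure M (E - ?U) = 0"
    using measure_nonneg[of M "E - ?U"] by linarith
  moreover have "measure M E = measure M (E \<inter> ?U) + measure M (E - ?U)"
    using finite_measure_Union[of "E \<inter> ?U" "E - ?U"] assms(5) U
    by (simp add: Int_Diff_disjoint Int_Diff_Un)
  moreover have "measure M (E \<inter> ?U) = (\<Sum>y\<in>I. measure M (E \<inter> B y))"
  proof -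
    have "E \<inter> ?U = (\<Union>y\<in>I. E \<inter> B y)" by auto
    moreover have "disjoint_family_on (\<lambda>y. E \<inter> B y) I"
      using assms(2) by (auto simp: disjoint_family_on_def)
    ultimately show ?thesis
      using assms by (subst finite_measure_finite_Union[symmetric]) auto
  qed
  ultimately show ?thesis by simp
qed

context walk_kernel
begin

definition nbrs :: "(nat \<Rightarrow> int) \<Rightarrow> (nat \<Rightarrow> int) set" where
  "nbrs x = insert x ((\<lambda>i. up i x) ` {..<d} \<union> (\<lambda>i. down i x) ` {..<d})"

lemma finite_nbrs: "finite (nbrs x)"
  by (simp add: nbrs_def)

text \<open>Links the point-mass description of the kernel to the operator. With \<open>f\<close>
  constantly 1 it says that a step stays in \<open>nbrs x\<close> with probability one.\<close>

lemma sum_rw_trans: "(\<Sum>y\<in>nbrs x. rw_trans d a b x y * f y) = Pop f x"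
proof -
  have pick: "(\<Sum>y\<in>nbrs x. (if y = z then k else 0) * f y) = k * f z" if "z \<in> nbrs x" for z k
  proof -
    have "(\<Sum>y\<in>nbrs x. (if y = z then k else 0) * f y) = (\<Sum>y\<in>nbrs x. if y = z then k * f y else 0)"
      by (intro sum.cong) auto
    then show ?thesis using that by (simp add: finite_nbrs)
  qed
  have in_nbrs: "x \<in> nbrs x" "i < d \<Longrightarrow> up i x \<in> nbrs x" "i < d \<Longrightarrow> down i x \<in> nbrs x" for i
    by (auto simp: nbrs_def)
  have "(\<Sum>y\<in>nbrs x. rw_trans d a b x y * f y) =
      (\<Sum>y\<in>nbrs x. \<Sum>i<d. (if y = up i x then a i (x i) else 0) * f y
          + (if y = down i x then b i (x i) else 0) * f y)
      + (\<Sum>y\<in>nbrs x. (if y = x then 1 - (\<Sum>i<d. a i (x i) + b i (x i)) else 0) * f y)"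
    unfolding rw_trans_def up_def[symmetric] down_def[symmetric]
    by (simp only: distrib_right sum_distrib_right sum.distrib)
  also have "(\<Sum>y\<in>nbrs x. \<Sum>i<d. (if y = up i x then a i (x i) else 0) * f y
          + (if y = down i x then b i (x i) else 0) * f y)
      = (\<Sum>i<d. a i (x i) * f (up i x) + b i (x i) * f (down i x))"
    by (subst sum.swap) (simp add: sum.distrib pick in_nbrs)
  finally show ?thesis
    by (simp add: pick in_nbrs Pop_def)
qed

text \<open>The probability, from \<open>x\<close>, that the position at each time \<open>j\<close>
  lies in the \<open>j\<close>-th listed set. The head of the list constrains \<open>x\<close>
  itself, at time 0.\<close>

fun path_fun :: "(nat \<Rightarrow> int) set list \<Rightarrow> (nat \<Rightarrow> int) \<Rightarrow> real" where
  "path_fun [] = (\<lambda>_. 1)"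
| "path_fun (C # Cs) = (\<lambda>x. indicat_real C x * Pop (path_fun Cs) x)"

lemma path_fun_replicate_UNIV: "path_fun (replicate n UNIV @ Cs) = (Pop ^^ n) (path_fun Cs)"
  by (induction n) simp_all

lemma funpow_Pop_cmult: "(Pop ^^ n) (\<lambda>x. k * f x) x = k * (Pop ^^ n) f x"
proof (induction n arbitrary: x)
  case (Suc n)
  then have "(Pop ^^ n) (\<lambda>x. k * f x) = (\<lambda>x. k * (Pop ^^ n) f x)" by auto
  then show ?case by (simp add: Pop_cmult)
qed simp

end

section \<open>Markov property and the criteria for recurrence and transience\<close>

locale walk = walk_kernel + prob_space M
  for M :: "'w measure" +
  fixes S :: "nat \<Rightarrow> 'w \<Rightarrow> nat \<Rightarrow> int"
  assumes is_walk: "is_walk M S d a b"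
begin

lemma S_measurable [measurable]: "S t \<in> measurable M (count_space UNIV)"
  using is_walk by (simp add: is_walk_def)

lemma sets_S_in: "{\<omega> \<in> space M. \<forall>j<n. S (t + j) \<omega> \<in> C j} \<in> sets M"
proof -
  have "{\<omega> \<in> space M. S k \<omega> \<in> D} \<in> sets M" for k D
    using measurable_sets[OF S_measurable, of D k] by (simp add: vimage_def Int_def conj_commute)
  then show ?thesis
    by (intro sets.sets_Collect_countable_All sets.sets_Collect_imp sets.sets_Collect_const)
qed

text \<open>The Markov property. The time \<open>t\<close> and the path \<open>xs\<close> stay
  general in the induction because each step lengthens the prescribed path by one of the neighbours
  of \<open>xs t\<close>; time \<open>t\<close> is constrained both by the path and by the first
  set.\<close>

lemma prob_path_event:
  "prob {\<omega> \<in> space M. (\<forall>k\<le>t. S k \<omega> = xs k) \<and> (\<forall>j<length Cs. S (t + j) \<omega> \<in> Cs ! j)}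
    = prob {\<omega> \<in> space M. \<forall>k\<le>t. S k \<omega> = xs k} * path_fun Cs (xs t)"
proof (induction Cs arbitrary: t xs)
  case Nil
  then show ?case by simp
next
  case (Cons C Cs)
  let ?D = "{\<omega> \<in> space M. \<forall>k\<le>t. S k \<omega> = xs k}"
  let ?E = "{\<omega> \<in> space M. (\<forall>k\<le>t. S k \<omega> = xs k) \<and> (\<forall>j<length (C # Cs). S (t + j) \<omega> \<in> (C # Cs) ! j)}"
  let ?B = "\<lambda>y. {\<omega> \<in> space M. \<forall>k\<le>Suc t. S k \<omega> = (xs(Suc t := y)) k}"
  show ?case
  proof (cases "xs t \<in> C")
    case False
    then have "?E = {}" by fastforce
    with False show ?thesis by (simp only: path_fun.simps) simp
  next
    case True
    have B: "prob (?B y) = prob ?D * rw_trans d a b (xs t) y" for y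
    proof -
      have "(\<Prod>k<t. rw_trans d a b ((xs(Suc t := y)) k) ((xs(Suc t := y)) (Suc k)))
          = (\<Prod>k<t. rw_trans d a b (xs k) (xs (Suc k)))"
        by (intro prod.cong) auto
      then show ?thesis using is_walk unfolding is_walk_def by simp
    qed
    have sum: "prob ?D = (\<Sum>y\<in>nbrs (xs t). prob (?B y))"
      using sum_rw_trans[of "xs t" "\<lambda>_. 1"] unfolding B by (simp add: sum_distrib_left[symmetric])
    have disj: "disjoint_family_on ?B (nbrs (xs t))"
      by (auto simp: disjoint_family_on_def)
    have sub: "?E \<subseteq> ?D" "?B y \<subseteq> ?D" for y by auto
    have meas: "?D \<in> sets M" "?B y \<in> sets M" for y by measurable
    have "?E \<in> sets M"
      using sets.sets_Collect_conj[OF sets_S_in meas(1)] .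
    then have "prob ?E = (\<Sum>y\<in>nbrs (xs t). prob (?E \<inter> ?B y))"
      by (rule measure_split_finite[OF finite_nbrs disj meas(2,1) _ sub sum])
    also have "\<dots> = (\<Sum>y\<in>nbrs (xs t). prob (?B y) * path_fun Cs y)"
    proof (intro sum.cong refl)
      fix y
      have "?E \<inter> ?B y = {\<omega> \<in> space M. (\<forall>k\<le>Suc t. S k \<omega> = (xs(Suc t := y)) k)
          \<and> (\<forall>j<length Cs. S (Suc t + j) \<omega> \<in> Cs ! j)}"
        using True by (auto simp: le_Suc_eq All_less_Suc2)
      then show "prob (?E \<inter> ?B y) = prob (?B y) * path_fun Cs y"
        using Cons.IH[of "Suc t" "xs(Suc t := y)"] by simp
    qed
    also have "\<dots> = prob ?D * Pop (path_fun Cs) (xs t)"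
      unfolding B sum_rw_trans[symmetric] by (simp add: sum_distrib_left mult.assoc)
    finally show ?thesis using True by simp
  qed
qed

lemma AE_start: "AE \<omega> in M. S 0 \<omega> = origin"
proof -
  have "prob {\<omega> \<in> space M. S 0 \<omega> = origin} = 1"
    using is_walk unfolding is_walk_def
    by (auto dest!: spec[of _ "0::nat"] spec[of _ "\<lambda>_. origin"])
  then show ?thesis
    by (subst (asm) prob_Collect_eq_1) auto
qed

lemma prob_event: "prob {\<omega> \<in> space M. \<forall>j<length Cs. S j \<omega> \<in> Cs ! j} = path_fun Cs origin"
proof -
  have "prob {\<omega> \<in> space M. \<forall>j<length Cs. S j \<omega> \<in> Cs ! j}
      = prob {\<omega> \<in> space M. S 0 \<omega> = origin \<and> (\<forall>j<length Cs. S j \<omega> \<in> Cs ! j)}"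
  proof (rule measure_eq_AE)
    show "AE \<omega> in M. (\<omega> \<in> {\<omega> \<in> space M. \<forall>j<length Cs. S j \<omega> \<in> Cs ! j}) =
        (\<omega> \<in> {\<omega> \<in> space M. S 0 \<omega> = origin \<and> (\<forall>j<length Cs. S j \<omega> \<in> Cs ! j)})"
      using AE_start by eventually_elim auto
    show *: "{\<omega> \<in> space M. \<forall>j<length Cs. S j \<omega> \<in> Cs ! j} \<in> sets M"
      using sets_S_in[of "length Cs" 0 "(!) Cs"] unfolding add_0 .
    have "{\<omega> \<in> space M. S 0 \<omega> = origin} \<in> sets M" by measurable
    from sets.sets_Collect_conj[OF * this]
    show "{\<omega> \<in> space M. S 0 \<omega> = origin \<and> (\<forall>j<length Cs. S j \<omega> \<in> Cs ! j)} \<in> sets M" .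
  qed
  moreover have "prob {\<omega> \<in> space M. S 0 \<omega> = origin} = 1"
    using AE_start by (subst prob_Collect_eq_1) auto
  ultimately show ?thesis
    using prob_path_event[of 0 "\<lambda>_. origin" Cs] by simp
qed

lemma prob_visit_avoid:
  "prob {\<omega> \<in> space M. S n \<omega> = origin \<and> (\<forall>j<k. S (n + Suc j) \<omega> \<noteq> origin)}
    = heat n origin * Pop (path_fun (replicate k (- {origin}))) origin"
proof -
  let ?A = "replicate k (- {origin})"
  let ?Cs = "replicate n UNIV @ {origin} # ?A"
  \<comment> \<open>The visit at time \<open>n\<close> pins the position, so the future factors out
    as a constant and a multiple of the point mass at the origin remains.\<close>
  have "path_fun ({origin} # ?A) = (\<lambda>x. Pop (path_fun ?A) origin * indicat_real {origin} x)"
    by (rule ext) (simp add: indicator_def)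
  then have "path_fun ?Cs origin = Pop (path_fun ?A) origin * heat n origin"
    unfolding path_fun_replicate_UNIV heat_def by (simp only: funpow_Pop_cmult)
  moreover have "(\<forall>j<length ?Cs. S j \<omega> \<in> ?Cs ! j) \<longleftrightarrow>
      S n \<omega> = origin \<and> (\<forall>j<k. S (n + Suc j) \<omega> \<noteq> origin)" for \<omega>
  proof safe
    assume *: "\<forall>j<length ?Cs. S j \<omega> \<in> ?Cs ! j"
    show "S n \<omega> = origin" using *[rule_format, of n] by (simp add: nth_append)
    fix j assume "j < k" "S (n + Suc j) \<omega> = origin"
    then show False using *[rule_format, of "n + Suc j"] by (simp add: nth_append)
  next
    fix j assume *: "S n \<omega> = origin" "\<forall>j<k. S (n + Suc j) \<omega> \<noteq> origin" "j < length ?Cs"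
    have "n < j \<Longrightarrow> j = n + Suc (j - Suc n) \<and> j - Suc n < k"
      using *(3) by auto
    then consider "j < n" | "j = n" | i where "i < k" "j = n + Suc i"
      by (metis linorder_less_linear)
    then show "S j \<omega> \<in> ?Cs ! j"
      using * by cases (auto simp: nth_append)
  qed
  ultimately show ?thesis
    using prob_event[of ?Cs] by (simp add: mult.commute)
qed

lemma prob_visit: "prob {\<omega> \<in> space M. S n \<omega> = origin} = heat n origin"
  using prob_visit_avoid[of n 0] by simp

lemma transient_if_summable:
  assumes "summable (\<lambda>n. heat n origin)"
  shows "transient M S"
proof -
  have "AE \<omega> in M. eventually (\<lambda>n. \<omega> \<in> space M - {\<omega> \<in> space M. S n \<omega> = origin}) sequentially"
    by (rule borel_cantelli_AE1) (auto simp: prob_visit assms emeasure_eq_measure)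
  then have "AE \<omega> in M. finite {t. S t \<omega> = origin}"
  proof eventually_elim
    case (elim \<omega>)
    then obtain N where "\<And>n. n \<ge> N \<Longrightarrow> S n \<omega> \<noteq> origin"
      by (auto simp: eventually_sequentially)
    then have "{t. S t \<omega> = origin} \<subseteq> {..<N}"
      by (auto simp: not_le[symmetric])
    then show ?case by (rule finite_subset) simp
  qed
  moreover have False if "AE \<omega> in M. infinite {t. S t \<omega> = origin}"
             "AE \<omega> in M. finite {t. S t \<omega> = origin}"
  proof -
    from that have "AE \<omega> in M. False" by eventually_elim simp
    then show False by simp
  qed
  ultimately show ?thesis
    unfolding transient_def recurrent_def by blast
qed

text \<open>By the Markov property the last visit to the origin is at time \<open>n\<close> with probability
  \<open>heat n origin\<close> times the escape probability. These events are disjoint, so a divergent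
  Green function forces the escape probability to vanish.\<close>

lemma recurrent_if_not_summable:
  assumes "\<not> summable (\<lambda>n. heat n origin)"
  shows "recurrent M S"
proof -
  define A where "A n = {\<omega> \<in> space M. S n \<omega> = origin \<and> (\<forall>j. S (n + Suc j) \<omega> \<noteq> origin)}" for n
  define B where "B n k = {\<omega> \<in> space M. S n \<omega> = origin \<and> (\<forall>j<k. S (n + Suc j) \<omega> \<noteq> origin)}" for n k
  have [measurable]: "A n \<in> sets M" "B n k \<in> sets M" for n k
    unfolding A_def B_def by measurable
  \<comment> \<open>Path probabilities only reach finite horizons; never returning is the decreasing
    limit of not returning within \<open>k\<close> steps.\<close>
  have lim: "(\<lambda>k. prob (B n k)) \<longlonglongrightarrow> prob (A n)" for n
  proof -
    have "A n = (\<Inter>k. B n k)" unfolding A_def B_def by auto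
    moreover have "decseq (B n)" unfolding B_def decseq_def by auto
    ultimately show ?thesis by (auto intro: finite_Lim_measure_decseq)
  qed
  have A: "prob (A n) = heat n origin * prob (A 0)" for n
  proof -
    have "prob (B n k) = heat n origin * prob (B 0 k)" for k
      using prob_visit_avoid[of n k] prob_visit_avoid[of 0 k] by (simp add: B_def heat_0)
    then have "(\<lambda>k. prob (B n k)) \<longlonglongrightarrow> heat n origin * prob (A 0)"
      using lim[of 0] by (auto intro: tendsto_intros)
    then show ?thesis using lim[of n] by (rule LIMSEQ_unique[rotated])
  qed
  have "disjoint_family A"
  proof -
    have "A m \<inter> A n = {}" if "m < n" for m n
      using that by (auto simp: A_def dest!: less_imp_Suc_add)
    then show ?thesis
      unfolding disjoint_family_on_def by (metis Int_commute linorder_neqE_nat)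
  qed
  then have bound: "(\<Sum>n<N. heat n origin) * prob (A 0) \<le> 1" for N
    using finite_measure_finite_Union[of "{..<N}" A] prob_le_1[of "\<Union>n<N. A n"]
    by (simp add: sum_distrib_right A[symmetric] image_subset_iff disjoint_family_on_def)
  have "prob (A 0) = 0"
  proof (rule ccontr)
    assume "prob (A 0) \<noteq> 0"
    then have "0 < prob (A 0)" by (simp add: zero_less_measure_iff)
    then have "(\<Sum>n<N. heat n origin) \<le> 1 / prob (A 0)" for N
      using bound[of N] by (simp add: field_simps)
    then have "summable (\<lambda>n. heat n origin)"
      by (intro summableI_nonneg_bounded heat_nonneg)
    with assms show False by simp
  qed
  then have "prob (A n) = 0" for n by (simp add: A[of n])
  then have "AE \<omega> in M. \<omega> \<notin> A n" for n
    by (intro AE_not_in) (simp add: null_sets_def emeasure_eq_measure)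
  then have "AE \<omega> in M. \<forall>n. \<omega> \<notin> A n" by (simp add: AE_all_countable)
  then have "AE \<omega> in M. infinite {t. S t \<omega> = origin}"
    using AE_start AE_space
  proof eventually_elim
    case (elim \<omega>)
    show ?case
    proof
      assume fin: "finite {t. S t \<omega> = origin}"
      let ?n = "Max {t. S t \<omega> = origin}"
      \<comment> \<open>The start at the origin makes the set of visit times nonempty, so its
        maximum really is a visit.\<close>
      have "S ?n \<omega> = origin" using Max_in[OF fin] elim by auto
      moreover have "S (?n + Suc j) \<omega> \<noteq> origin" for j
        using Max_ge[OF fin, of "?n + Suc j"] by auto
      ultimately show False using elim by (auto simp: A_def)
    qed
  qed
  then show ?thesis by (simp add: recurrent_def)
qed

end

subsection \<open>Zero capacity in the plane\<close>

context reversible_walk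
begin

text \<open>A single term of \<open>ip (heat n) (heat n)\<close> is at most the whole sum, which is
  a return probability at time \<open>2 * n\<close>; hence decay at the origin spreads to every
  point.\<close>

lemma heat_tendsto_0:
  assumes "(\<lambda>n. heat n origin) \<longlonglongrightarrow> 0"
  shows "(\<lambda>n. heat n x) \<longlonglongrightarrow> 0"
proof -
  have bound: "(heat n x)\<^sup>2 \<le> w origin / w x * heat (2 * n) origin" for n
  proof -
    have "(\<Sum>y\<in>{x}. w y * heat n y * heat n y) \<le> ip (heat n) (heat n)"
      unfolding ip_def using w_pos
      by (intro finite_sum_le_infsum finsupp_summable finsupp_mult_right finsupp_heat)
        (auto simp: heat_nonneg less_imp_le)
    then have "w x * (heat n x)\<^sup>2 \<le> w origin * heat (2 * n) origin"
      by (simp add: ip_heat power2_eq_square mult_2 mult.assoc)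
    then show ?thesis using w_pos[of x] by (simp add: field_simps)
  qed
  have "strict_mono (\<lambda>n::nat. 2 * n)" by (auto intro: strict_monoI)
  from LIMSEQ_subseq_LIMSEQ[OF assms this]
  have "(\<lambda>n. w origin / w x * heat (2 * n) origin) \<longlonglongrightarrow> w origin / w x * 0"
    by (intro tendsto_mult tendsto_const) (simp add: o_def)
  then have "(\<lambda>n. (heat n x)\<^sup>2) \<longlonglongrightarrow> 0"
    by (intro tendsto_sandwich[OF _ always_eventually[OF allI[OF bound]] tendsto_const]) simp_all
  from tendsto_real_sqrt[OF this] show ?thesis by (simp add: heat_nonneg)
qed

lemma ip_heat_tendsto_0:
  assumes "finsupp f" "(\<lambda>n. heat n origin) \<longlonglongrightarrow> 0"
  shows "(\<lambda>n. ip f (heat n)) \<longlonglongrightarrow> 0"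
proof -
  have "ip f (heat n) = (\<Sum>x\<in>{x. f x \<noteq> 0}. w x * f x * heat n x)" for n
  proof -
    have "ip f (heat n) = (\<Sum>\<^sub>\<infinity>x\<in>{x. f x \<noteq> 0}. w x * f x * heat n x)"
      unfolding ip_def by (rule infsum_cong_neutral) auto
    then show ?thesis using assms(1) by (simp add: finsupp_def)
  qed
  moreover have "(\<lambda>n. \<Sum>x\<in>{x. f x \<noteq> 0}. w x * f x * heat n x) \<longlonglongrightarrow> (\<Sum>x\<in>{x. f x \<noteq> 0}. w x * f x * 0)"
    by (intro tendsto_sum tendsto_mult tendsto_const heat_tendsto_0[OF assms(2)])
  ultimately show ?thesis by simp
qed

text \<open>Testing \<open>(I - P) (green N) = heat 0 - heat N\<close> against \<open>f\<close> bounds \<open>w origin\<close> by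
  \<open>form f (green N)\<close>, up to a term that vanishes as \<open>N\<close> grows.\<close>

lemma not_summable_if_zero_capacity:
  assumes "\<And>\<epsilon>. 0 < \<epsilon> \<Longrightarrow> \<exists>f. finsupp f \<and> f origin = 1 \<and> form f f \<le> \<epsilon>"
  shows "\<not> summable (\<lambda>n. heat n origin)"
proof
  assume summ: "summable (\<lambda>n. heat n origin)"
  define G where "G = (\<Sum>n. heat n origin)"
  have green_le: "green N origin \<le> G" for N
    unfolding green_def G_def by (intro sum_le_suminf summ) (auto simp: heat_nonneg)
  have "green 1 origin = 1" by (simp add: green_def heat_0)
  then have G: "1 \<le> G" using green_le[of 1] by simp
  have w0: "0 < w origin" by (rule w_pos)
  \<comment> \<open>Young's inequality with parameter \<open>G\<close> bounds twice
    \<open>w origin\<close> by \<open>G * \<epsilon> + w origin\<close> in the limit. Any choice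
    with \<open>G * \<epsilon>\<close> below \<open>w origin\<close> gives the contradiction; this
    one makes it half.\<close>
  define \<epsilon> where "\<epsilon> = w origin / (2 * G)"
  have "0 < \<epsilon>" using G w0 by (simp add: \<epsilon>_def)
  then obtain f where f: "finsupp f" "f origin = 1" "form f f \<le> \<epsilon>"
    using assms by blast
  have "2 * (w origin - ip f (heat N)) \<le> G * \<epsilon> + w origin" for N
  proof -
    have "form f (green N) = ip f (\<lambda>x. heat 0 x - heat N x)"
      using ip_laplace[OF f(1) finsupp_green, of N] by (simp add: green_laplace)
    also have "\<dots> = w origin - ip f (heat N)"
      by (simp add: ip_diff_right f heat_0 ip_commute[of f "indicat_real _"] ip_indicator)
    finally have "2 * (w origin - ip f (heat N)) = 2 * form f (green N)" by simp
    also have "\<dots> \<le> G * form f f + form (green N) (green N) / G"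
      using G by (intro form_le_young f finsupp_green) simp
    also have "\<dots> \<le> G * \<epsilon> + w origin * G / G"
    proof (intro add_mono mult_left_mono divide_right_mono)
      show "form (green N) (green N) \<le> w origin * G"
        using form_green_le[of N] mult_left_mono[OF green_le[of N], of "w origin"] w0 by linarith
    qed (use f G in auto)
    finally show ?thesis using G by simp
  qed
  moreover have "(\<lambda>N. 2 * (w origin - ip f (heat N))) \<longlonglongrightarrow> 2 * (w origin - 0)"
    by (intro tendsto_intros ip_heat_tendsto_0 f summable_LIMSEQ_zero[OF summ])
  ultimately have "2 * (w origin - 0) \<le> G * \<epsilon> + w origin"
    by (intro LIMSEQ_le_const2) auto
  moreover have "G * \<epsilon> = w origin / 2" using G by (simp add: \<epsilon>_def)
  ultimately show False using w0 by simp
qed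

end

section \<open>Logarithmic cutoff functions\<close>

definition plane_norm :: "(nat \<Rightarrow> int) \<Rightarrow> nat" where
  "plane_norm x = nat (max \<bar>x 0\<bar> \<bar>x 1\<bar>)"

definition plane :: "(nat \<Rightarrow> int) set" where
  "plane = {x. \<forall>i\<ge>2. x i = 0}"

text \<open>The discrete form of 1 - log |x| / log N, with \<open>harm\<close> as logarithm: value 1
  at the origin, 0 from radius \<open>N\<close> on. Points have infinitely many coordinates, so
  finite support forces the restriction to \<open>plane\<close>, which steps in directions 0 and 1
  preserve. The same function serves in dimension one.\<close>

definition cutoff :: "nat \<Rightarrow> (nat \<Rightarrow> int) \<Rightarrow> real" where
  "cutoff N x = (if x \<in> plane then 1 - harm (min (plane_norm x) N) / harm N else 0)"

text \<open>Two pairs of opposite sides of the square cover the sphere, with at most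
  \<open>4 * (2 * r + 1)\<close> points; the rounding to \<open>8 * (r + 1)\<close> matches the
  denominators of the gradient bound.\<close>

lemma plane_sphere_finite: "finite {x \<in> plane. plane_norm x = r}" (is ?fin)
  and plane_sphere_card: "card {x \<in> plane. plane_norm x = r} \<le> 8 * (r + 1)" (is ?card)
proof -
  let ?e = "\<lambda>(m, n). origin(0 := m, 1 := n)"
  let ?I = "{- int r..int r}" and ?P = "{int r, - int r}"
  have sub: "{x \<in> plane. plane_norm x = r} \<subseteq> ?e ` (?I \<times> ?P \<union> ?P \<times> ?I)"
  proof
    fix x assume "x \<in> {x \<in> plane. plane_norm x = r}"
    then have x: "\<And>i. 2 \<le> i \<Longrightarrow> x i = 0" "max \<bar>x 0\<bar> \<bar>x 1\<bar> = int r"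
      by (auto simp: plane_def plane_norm_def)
    have "x = ?e (x 0, x 1)"
    proof
      fix i show "x i = ?e (x 0, x 1) i"
        using x(1)[of i] by (cases "i = 0"; cases "i = 1") (auto simp: origin_def)
    qed
    moreover have "(x 0, x 1) \<in> ?I \<times> ?P \<union> ?P \<times> ?I"
      using x(2) by auto
    ultimately show "x \<in> ?e ` (?I \<times> ?P \<union> ?P \<times> ?I)" by (rule image_eqI)
  qed
  have fin: "finite (?I \<times> ?P \<union> ?P \<times> ?I)" by simp
  have card: "card (?I \<times> ?P \<union> ?P \<times> ?I) \<le> 8 * (r + 1)"
  proof -
    have "card ?P \<le> 2" by (simp add: card_insert_if)
    then have "card (?I \<times> ?P) \<le> (2 * r + 1) * 2" "card (?P \<times> ?I) \<le> 2 * (2 * r + 1)"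
      unfolding card_cartesian_product by (intro mult_mono; simp)+
    then show ?thesis using card_Un_le[of "?I \<times> ?P" "?P \<times> ?I"] by (simp add: algebra_simps)
  qed
  show ?fin by (rule finite_subset[OF sub finite_imageI[OF fin]])
  show ?card by (rule order.trans[OF surj_card_le[OF fin sub] card])
qed

lemma harm_step: "harm (Suc r) - harm r = 1 / (real r + 1)"
  by (simp add: harm_Suc field_simps)

text \<open>A step changes the radius by at most one. An outward step from radius r costs at most
  1/(r+1), an inward one at most 1/r, hence at most 2/(r+1); squaring gives the 4. Beyond radius
  \<open>N\<close> both endpoints have value 0.\<close>

lemma cutoff_gradient:
  assumes "i < 2" "N \<ge> 1"
  shows "(cutoff N (up i x) - cutoff N x)\<^sup>2 \<le>
    (if x \<in> plane \<and> plane_norm x \<le> N then 4 / ((real (plane_norm x) + 1)\<^sup>2 * (harm N)\<^sup>2) else 0)"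
proof (cases "x \<in> plane")
  case False
  moreover have "up i x \<notin> plane" using False assms(1) by (auto simp: plane_def up_def)
  ultimately show ?thesis by (auto simp: cutoff_def plane_def)
next
  case True
  have up: "up i x \<in> plane" using True assms(1) by (auto simp: plane_def up_def)
  have H: "0 < (harm N :: real)" using assms by (simp add: harm_pos)
  let ?r = "plane_norm x" and ?s = "plane_norm (up i x)"
  have i: "i = 0 \<or> i = 1" using assms(1) by auto
  have near: "?s \<le> Suc ?r" "?r \<le> Suc ?s"
    using i by (auto simp: plane_norm_def up_def)
  have diff: "cutoff N (up i x) - cutoff N x = (harm (min ?r N) - harm (min ?s N)) / harm N"
    using True up by (simp add: cutoff_def plane_def diff_divide_distrib)
  show ?thesis
  proof (cases "?r \<le> N")
    case False
    then have "min ?r N = N" "min ?s N = N" using near by auto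
    then show ?thesis using False unfolding diff by simp
  next
    case le: True
    have step: "\<bar>harm (min r N) - harm (min (Suc r) N)\<bar> \<le> 1 / (real r + 1)" for r
    proof (cases "Suc r \<le> N")
      case True
      then show ?thesis using harm_step[of r] harm_mono[of r "Suc r", where ?'a = real]
        by (simp add: min_def abs_le_iff)
    next
      case False
      then have "min r N = N" "min (Suc r) N = N" by auto
      then show ?thesis by simp
    qed
    have "\<bar>harm (min ?r N) - harm (min ?s N)\<bar> \<le> 2 / (real ?r + 1)"
    proof -
      consider "?s = ?r" | "?s = Suc ?r" | "?r = Suc ?s" using near by linarith
      then show ?thesis
      proof cases
        case 2
        then show ?thesis using step[of ?r] by (simp add: field_simps)
      next
        case 3
        have "1 / (real ?s + 1) \<le> 2 / (real ?r + 1)" using 3 by (simp add: field_simps)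
        then show ?thesis using step[of ?s] 3 by (simp add: abs_minus_commute)
      qed simp
    qed
    then have "\<bar>cutoff N (up i x) - cutoff N x\<bar> \<le> 2 / (real ?r + 1) / harm N"
      unfolding diff abs_divide using H by (intro divide_mono) auto
    then have "(cutoff N (up i x) - cutoff N x)\<^sup>2 \<le> (2 / (real ?r + 1) / harm N)\<^sup>2"
      by (metis abs_ge_zero power2_abs power_mono)
    then show ?thesis using True le by (simp add: power_divide power_mult_distrib)
  qed
qed

lemma plane_ball_finite: "finite {x \<in> plane. plane_norm x \<le> N}"
proof -
  have "{x \<in> plane. plane_norm x \<le> N} = (\<Union>r\<le>N. {x \<in> plane. plane_norm x = r})" by auto
  then show ?thesis using plane_sphere_finite by simp
qed

lemma finsupp_cutoff: "N \<ge> 1 \<Longrightarrow> finsupp (cutoff N)"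
  unfolding finsupp_def
proof (rule finite_subset[OF _ plane_ball_finite[of N]])
  assume "N \<ge> 1"
  then have "harm N \<noteq> (0 :: real)" by (metis harm_pos less_le_trans less_irrefl zero_less_one)
  then show "{x. cutoff N x \<noteq> 0} \<subseteq> {x \<in> plane. plane_norm x \<le> N}"
    by (auto simp: cutoff_def plane_def min_def split: if_splits)
qed

text \<open>A shell of order r points with squared gradient of order 1/r^2 leaves a harmonic sum. It
  has the size of \<open>harm N\<close>, against a normalisation by \<open>(harm N)\<^sup>2\<close>,
  so the energy vanishes logarithmically.\<close>

lemma cutoff_energy:
  assumes "i < 2" "N \<ge> 1"
  shows "(\<Sum>\<^sub>\<infinity>x. (cutoff N (up i x) - cutoff N x)\<^sup>2) \<le> 64 / harm N"
proof -
  let ?B = "{x \<in> plane. plane_norm x \<le> N}"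
  let ?h = "\<lambda>x. 4 / ((real (plane_norm x) + 1)\<^sup>2 * (harm N)\<^sup>2)"
  have H: "1 \<le> (harm N :: real)"
    using harm_mono[OF assms(2), where ?'a = real] by (simp add: harm_def)
  have fs: "finsupp (\<lambda>x. (cutoff N (up i x) - cutoff N x)\<^sup>2)"
    by (rule finsupp_mono[OF finsupp_diff[OF finsupp_up[of "cutoff N" i] ]])
      (use finsupp_cutoff[OF assms(2)] in simp_all)
  have "(\<Sum>\<^sub>\<infinity>x. (cutoff N (up i x) - cutoff N x)\<^sup>2) \<le> (\<Sum>\<^sub>\<infinity>x\<in>?B. ?h x)"
  proof (rule infsum_mono_neutral)
    show "?h summable_on ?B" using plane_ball_finite by simp
  next
    fix x assume "x \<in> UNIV \<inter> ?B"
    then show "(cutoff N (up i x) - cutoff N x)\<^sup>2 \<le> ?h x"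
      using cutoff_gradient[OF assms, of x] by auto
  next
    fix x assume "x \<in> UNIV - ?B"
    then have "\<not> (x \<in> plane \<and> plane_norm x \<le> N)" by auto
    then show "(cutoff N (up i x) - cutoff N x)\<^sup>2 \<le> 0"
      using cutoff_gradient[OF assms, of x] by (simp only: if_False)
  qed (auto simp: finsupp_summable[OF fs])
  also have "\<dots> = (\<Sum>x\<in>?B. ?h x)" using plane_ball_finite by simp
  also have "\<dots> = (\<Sum>r\<le>N. \<Sum>x\<in>{x \<in> ?B. plane_norm x = r}. ?h x)"
    by (rule sum.group[symmetric]) (use plane_ball_finite in auto)
  also have "\<dots> \<le> (\<Sum>r\<le>N. 32 / (real r + 1) / (harm N)\<^sup>2)"
  proof (rule sum_mono)
    fix r assume "r \<in> {..N}"
    then have eq: "{x \<in> ?B. plane_norm x = r} = {x \<in> plane. plane_norm x = r}" by auto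
    have "(\<Sum>x\<in>{x \<in> ?B. plane_norm x = r}. ?h x)
        = real (card {x \<in> plane. plane_norm x = r}) * (4 / ((real r + 1)\<^sup>2 * (harm N)\<^sup>2))"
      unfolding eq by simp
    also have "\<dots> \<le> real (8 * (r + 1)) * (4 / ((real r + 1)\<^sup>2 * (harm N)\<^sup>2))"
      by (intro mult_right_mono) (use plane_sphere_card[of r] in \<open>simp_all only: of_nat_le_iff\<close>, simp)
    also have "\<dots> = 32 / (real r + 1) / (harm N)\<^sup>2"
    proof -
      have "8 * R * (4 / (R\<^sup>2 * h)) = 32 / R / h" if "0 < R" for R h :: real
        using that by (simp add: power2_eq_square)
      from this[of "real r + 1" "(harm N)\<^sup>2"] show ?thesis by (simp add: algebra_simps)
    qed
    finally show "(\<Sum>x\<in>{x \<in> ?B. plane_norm x = r}. ?h x) \<le> 32 / (real r + 1) / (harm N)\<^sup>2" .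
  qed
  also have "\<dots> = 32 * harm (Suc N) / (harm N)\<^sup>2"
  proof -
    have "harm (Suc N) = (\<Sum>r\<le>N. 1 / (real r + 1))"
      unfolding harm_altdef lessThan_Suc_atMost by (simp add: inverse_eq_divide add.commute)
    then show ?thesis by (simp add: sum_distrib_left sum_divide_distrib)
  qed
  also have "\<dots> \<le> 32 * (2 * harm N) / (harm N)\<^sup>2"
  proof -
    have "harm (Suc N) \<le> 2 * (harm N :: real)" 
    proof -
      have "1 / (real N + 1) \<le> 1" by simp
      then show ?thesis using harm_step[of N] H by linarith
    qed
    then show ?thesis by (intro divide_right_mono) auto
  qed
  also have "\<dots> = 64 / harm N" using H by (simp add: power2_eq_square)
  finally show ?thesis .
qed

lemma (in reversible_walk) zero_capacity_plane:
  assumes "d \<le> 2" and w_le: "\<And>x. w x \<le> W" and a_le: "\<And>i z. i < d \<Longrightarrow> a i z \<le> 1" and "0 < \<epsilon>"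
  shows "\<exists>f. finsupp f \<and> f origin = 1 \<and> form f f \<le> \<epsilon>"
proof -
  have W: "0 < W" using w_pos[of origin] w_le[of origin] by linarith
  \<comment> \<open>At most two directions, each with energy at most
    \<open>W * (64 / harm N)\<close>, account for the 128.\<close>
  obtain N where N: "N \<ge> 1" "harm N \<ge> 128 * W / \<epsilon>"
  proof -
    have "filterlim (harm :: nat \<Rightarrow> real) at_top at_top" by (rule harm_at_top)
    then have "eventually (\<lambda>N. harm N \<ge> 128 * W / \<epsilon>) at_top"
      by (simp add: filterlim_at_top)
    then obtain N0 where "\<And>N. N \<ge> N0 \<Longrightarrow> harm N \<ge> 128 * W / \<epsilon>"
      by (auto simp: eventually_sequentially)
    then show ?thesis by (intro that[of "max 1 N0"]) auto
  qed
  have H: "0 < (harm N :: real)" using N by (simp add: harm_pos)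
  let ?f = "cutoff N"
  have fs: "finsupp ?f" by (rule finsupp_cutoff[OF N(1)])
  have fd: "finsupp (\<lambda>x. ?f (up i x) - ?f x)" for i by (intro finsupp_diff finsupp_up fs)
  have "(\<Sum>\<^sub>\<infinity>x. w x * a i (x i) * (?f (up i x) - ?f x) * (?f (up i x) - ?f x)) \<le> W * (64 / harm N)"
    if "i < d" for i
  proof -
    have "(\<Sum>\<^sub>\<infinity>x. w x * a i (x i) * (?f (up i x) - ?f x) * (?f (up i x) - ?f x))
        \<le> (\<Sum>\<^sub>\<infinity>x. W * (?f (up i x) - ?f x)\<^sup>2)"
    proof (rule infsum_mono)
      fix x
      have "w x * a i (x i) \<le> W * 1"
        using W w_le a_le[OF that] a_nonneg[OF that] by (intro mult_mono) auto
      then show "w x * a i (x i) * (?f (up i x) - ?f x) * (?f (up i x) - ?f x) \<le> W * (?f (up i x) - ?f x)\<^sup>2"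
        using mult_right_mono[of "w x * a i (x i)" W "(?f (up i x) - ?f x)\<^sup>2"]
        by (simp add: power2_eq_square mult.assoc)
    next
      show "(\<lambda>x. w x * a i (x i) * (?f (up i x) - ?f x) * (?f (up i x) - ?f x)) summable_on UNIV"
        by (intro finsupp_summable finsupp_mult_right fd)
      show "(\<lambda>x. W * (?f (up i x) - ?f x)\<^sup>2) summable_on UNIV"
        unfolding power2_eq_square by (intro finsupp_summable finsupp_mult_right fd)
    qed
    also have "\<dots> = W * (\<Sum>\<^sub>\<infinity>x. (?f (up i x) - ?f x)\<^sup>2)"
      by (rule infsum_cmult_right')
    also have "\<dots> \<le> W * (64 / harm N)"
      using that assms(1) W N by (intro mult_left_mono cutoff_energy) auto
    finally show ?thesis .
  qed
  then have "form ?f ?f \<le> (\<Sum>i<d. W * (64 / harm N))"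
    unfolding form_def by (intro sum_mono) auto
  also have "\<dots> \<le> 2 * (W * (64 / harm N))"
  proof -
    have "0 \<le> W * (64 / harm N)"
      using less_imp_le[OF W] less_imp_le[OF H] by (intro mult_nonneg_nonneg divide_nonneg_nonneg) simp_all
    then have "real d * (W * (64 / harm N)) \<le> 2 * (W * (64 / harm N))"
      using assms(1) by (intro mult_right_mono) simp_all
    then show ?thesis by simp
  qed
  also have "\<dots> \<le> \<epsilon>" using N(2) H assms(4) by (simp add: field_simps)
  finally have "form ?f ?f \<le> \<epsilon>" .
  moreover have "?f origin = 1"
    by (simp add: cutoff_def plane_def origin_def plane_norm_def harm_def)
  ultimately show ?thesis using fs by blast
qed

subsection \<open>A flow of finite energy in the octant\<close>

definition states :: "nat \<Rightarrow> (nat \<times> nat \<times> nat) set" where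
  "states n = {(i, j, k). i + j + k = n}"

lemma finite_states: "finite (states n)"
  by (rule finite_subset[of _ "{..n} \<times> {..n} \<times> {..n}"]) (auto simp: states_def)

text \<open>The Polya urn started with one ball of each of three colours is uniformly distributed on
  \<open>states n\<close> after \<open>n\<close> draws; \<open>urn n\<close> is the mass of a point.\<close>

definition urn :: "nat \<Rightarrow> real" where
  "urn n = 2 / ((real n + 1) * (real n + 2))"

text \<open>Adding a ball of one colour misses exactly the states of level \<open>Suc n\<close>
  without a drawn ball of that colour, and there the factor on the right vanishes.\<close>

lemma sum_states_shift:
  fixes F :: "nat \<Rightarrow> nat \<Rightarrow> nat \<Rightarrow> real"
  shows "(\<Sum>(i, j, k)\<in>states n. (real i + 1) * F (Suc i) j k) = (\<Sum>(i, j, k)\<in>states (Suc n). real i * F i j k)"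
    and "(\<Sum>(i, j, k)\<in>states n. (real j + 1) * F i (Suc j) k) = (\<Sum>(i, j, k)\<in>states (Suc n). real j * F i j k)"
    and "(\<Sum>(i, j, k)\<in>states n. (real k + 1) * F i j (Suc k)) = (\<Sum>(i, j, k)\<in>states (Suc n). real k * F i j k)"
proof -
  show "(\<Sum>(i, j, k)\<in>states n. (real i + 1) * F (Suc i) j k) = (\<Sum>(i, j, k)\<in>states (Suc n). real i * F i j k)"
    by (rule sum.reindex_bij_witness_not_neutral[where S' = "{}" and T' = "{(i, j, k) \<in> states (Suc n). i = 0}"
          and j = "\<lambda>(i, j, k). (Suc i, j, k)" and i = "\<lambda>(i, j, k). (i - 1, j, k)"])
      (auto simp: finite_states states_def algebra_simps intro: finite_subset[OF _ finite_states[of "Suc n"]])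
  show "(\<Sum>(i, j, k)\<in>states n. (real j + 1) * F i (Suc j) k) = (\<Sum>(i, j, k)\<in>states (Suc n). real j * F i j k)"
    by (rule sum.reindex_bij_witness_not_neutral[where S' = "{}" and T' = "{(i, j, k) \<in> states (Suc n). j = 0}"
          and j = "\<lambda>(i, j, k). (i, Suc j, k)" and i = "\<lambda>(i, j, k). (i, j - 1, k)"])
      (auto simp: finite_states states_def algebra_simps intro: finite_subset[OF _ finite_states[of "Suc n"]])
  show "(\<Sum>(i, j, k)\<in>states n. (real k + 1) * F i j (Suc k)) = (\<Sum>(i, j, k)\<in>states (Suc n). real k * F i j k)"
    by (rule sum.reindex_bij_witness_not_neutral[where S' = "{}" and T' = "{(i, j, k) \<in> states (Suc n). k = 0}"
          and j = "\<lambda>(i, j, k). (i, j, Suc k)" and i = "\<lambda>(i, j, k). (i, j, k - 1)"])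
      (auto simp: finite_states states_def algebra_simps intro: finite_subset[OF _ finite_states[of "Suc n"]])
qed

text \<open>After \<open>n\<close> draws the urn holds \<open>n + 3\<close> balls,
  \<open>i + 1\<close> of the first colour, so \<open>urn n * (i + 1) / (n + 3)\<close> is the flow
  along that edge. The right side pairs this flow with the gradient of \<open>F\<close>. The inflow
  at a state of level \<open>n + 1\<close> is \<open>urn n * (n + 1) / (n + 3)\<close>, which is
  \<open>urn (Suc n)\<close>: the flow is conserved.\<close>

lemma urn_flow:
  fixes F :: "nat \<Rightarrow> nat \<Rightarrow> nat \<Rightarrow> real"
  shows "urn n * (\<Sum>(i, j, k)\<in>states n. F i j k) - urn (Suc n) * (\<Sum>(i, j, k)\<in>states (Suc n). F i j k)
    = urn n / (real n + 3) * (\<Sum>(i, j, k)\<in>states n. (real i + 1) * (F i j k - F (Suc i) j k)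
        + (real j + 1) * (F i j k - F i (Suc j) k) + (real k + 1) * (F i j k - F i j (Suc k)))"
proof -
  let ?T = "\<Sum>(i, j, k)\<in>states n. F i j k" and ?T' = "\<Sum>(i, j, k)\<in>states (Suc n). F i j k"
  have "(\<Sum>(i, j, k)\<in>states n. (real i + 1) * (F i j k - F (Suc i) j k)
        + (real j + 1) * (F i j k - F i (Suc j) k) + (real k + 1) * (F i j k - F i j (Suc k)))
      = (\<Sum>(i, j, k)\<in>states n. (real n + 3) * F i j k)
        - ((\<Sum>(i, j, k)\<in>states n. (real i + 1) * F (Suc i) j k)
          + (\<Sum>(i, j, k)\<in>states n. (real j + 1) * F i (Suc j) k)
          + (\<Sum>(i, j, k)\<in>states n. (real k + 1) * F i j (Suc k)))"
    unfolding sum.distrib[symmetric] sum_subtractf[symmetric]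
    by (rule sum.cong) (auto simp: states_def algebra_simps)
  also have "(\<Sum>(i, j, k)\<in>states n. (real i + 1) * F (Suc i) j k)
          + (\<Sum>(i, j, k)\<in>states n. (real j + 1) * F i (Suc j) k)
          + (\<Sum>(i, j, k)\<in>states n. (real k + 1) * F i j (Suc k))
      = (\<Sum>(i, j, k)\<in>states (Suc n). (real n + 1) * F i j k)"
    unfolding sum_states_shift sum.distrib[symmetric]
  proof (rule sum.cong, simp, clarify)
    fix i j k assume "(i, j, k) \<in> states (Suc n)"
    then have n: "real n + 1 = real i + real j + real k" by (auto simp: states_def)
    show "real i * F i j k + real j * F i j k + real k * F i j k = (real n + 1) * F i j k"
      unfolding n by (simp add: algebra_simps)
  qed
  also have "(\<Sum>(i, j, k)\<in>states n. (real n + 3) * F i j k) = (real n + 3) * ?T"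
    by (simp add: sum_distrib_left case_prod_unfold)
  also have "(\<Sum>(i, j, k)\<in>states (Suc n). (real n + 1) * F i j k) = (real n + 1) * ?T'"
    by (simp add: sum_distrib_left case_prod_unfold)
  finally have eq: "(\<Sum>(i, j, k)\<in>states n. (real i + 1) * (F i j k - F (Suc i) j k)
        + (real j + 1) * (F i j k - F i (Suc j) k) + (real k + 1) * (F i j k - F i j (Suc k)))
      = (real n + 3) * ?T - (real n + 1) * ?T'" .
  define c where "c = urn n / (real n + 3)"
  have "urn (Suc n) = c * (real n + 1)"
    unfolding c_def urn_def by (simp add: divide_simps) (simp add: algebra_simps)
  moreover have "urn n = c * (real n + 3)" by (simp add: c_def)
  ultimately show ?thesis unfolding eq c_def[symmetric] by (simp add: algebra_simps)
qed

text \<open>A constant \<open>F\<close> has no gradient, so \<open>urn_flow\<close> makes the total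
  mass the same on all levels; the states are never counted.\<close>

lemma urn_card_states: "urn n * real (card (states n)) = 1"
proof (induction n)
  case 0
  have "states 0 = {(0, 0, 0)}" by (auto simp: states_def)
  then show ?case by (simp add: urn_def)
next
  case (Suc n)
  then show ?case using urn_flow[of n "\<lambda>_ _ _. 1"] by (simp add: case_prod_unfold)
qed

text \<open>\<open>urn n\<close> bounds the energy of the flow through level \<open>n\<close>. This
  is where three dimensions matter: two colours would give mass 1/(n+1) per state and a divergent
  sum.\<close>

lemma sum_urn_le: "(\<Sum>n<N. urn n) \<le> 2"
proof -
  have "(\<Sum>n<N. urn n) = 2 - 2 / (real N + 1)"
  proof (induction N)
    case (Suc N)
    have "urn N = 2 / (real N + 1) - 2 / (real N + 2)"
      unfolding urn_def by (simp add: divide_simps)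
    with Suc show ?case by (simp add: add.commute)
  qed simp
  then show ?thesis by simp
qed

text \<open>The mean of \<open>F\<close> over level \<open>n\<close> runs from
  \<open>F 0 0 0\<close> at level 0 to 0 at level \<open>N\<close>. Each decrement is a pairing of
  flow and gradient, which Young's inequality splits edge by edge into flow energy and energy of
  \<open>F\<close>.\<close>

lemma urn_energy_bound:
  fixes F :: "nat \<Rightarrow> nat \<Rightarrow> nat \<Rightarrow> real"
  assumes l: "0 < l" and zero: "\<And>i j k. i + j + k \<ge> N \<Longrightarrow> F i j k = 0"
  shows "2 * F 0 0 0 \<le> 2 * l + (\<Sum>n<N. \<Sum>(i, j, k)\<in>states n.
    (F (Suc i) j k - F i j k)\<^sup>2 + (F i (Suc j) k - F i j k)\<^sup>2 + (F i j (Suc k) - F i j k)\<^sup>2) / l"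
proof -
  define A where "A n = urn n * (\<Sum>(i, j, k)\<in>states n. F i j k)" for n
  let ?E = "\<lambda>n. \<Sum>(i, j, k)\<in>states n.
    (F (Suc i) j k - F i j k)\<^sup>2 + (F i (Suc j) k - F i j k)\<^sup>2 + (F i j (Suc k) - F i j k)\<^sup>2"
  have young: "2 * (t * D) \<le> l * t\<^sup>2 + D\<^sup>2 / l" for t D :: real
  proof -
    have "0 \<le> (l * t - D)\<^sup>2 / l" using l by simp
    also have "\<dots> = l * t\<^sup>2 + D\<^sup>2 / l - 2 * (t * D)"
      using l by (simp add: power2_eq_square field_simps)
    finally show ?thesis by simp
  qed
  have step: "2 * (A n - A (Suc n)) \<le> l * urn n + ?E n / l" for n
  proof -
    define c where "c = urn n / (real n + 3)"
    have c: "c * (real n + 3) = urn n" by (simp add: c_def)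
    have pos: "0 \<le> c" by (simp add: c_def urn_def)
    have "2 * (A n - A (Suc n)) = (\<Sum>(i, j, k)\<in>states n.
        2 * (c * (real i + 1) * (F i j k - F (Suc i) j k))
        + 2 * (c * (real j + 1) * (F i j k - F i (Suc j) k))
        + 2 * (c * (real k + 1) * (F i j k - F i j (Suc k))))"
      unfolding A_def urn_flow c_def[symmetric]
      by (simp add: sum_distrib_left case_prod_unfold algebra_simps)
    also have "\<dots> \<le> (\<Sum>(i, j, k)\<in>states n. l * (urn n)\<^sup>2
        + ((F (Suc i) j k - F i j k)\<^sup>2 + (F i (Suc j) k - F i j k)\<^sup>2 + (F i j (Suc k) - F i j k)\<^sup>2) / l)"
    proof (rule sum_mono, clarify)
      fix i j k assume "(i, j, k) \<in> states n"
      then have n: "real n = real i + real j + real k" by (auto simp: states_def)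
      \<comment> \<open>The three flows out of a state are nonnegative with sum
        \<open>urn n\<close>, so their squares add up to at most the square of that sum.\<close>
      have "(c * (real i + 1))\<^sup>2 + (c * (real j + 1))\<^sup>2 + (c * (real k + 1))\<^sup>2
          \<le> (c * (real i + 1) + c * (real j + 1) + c * (real k + 1))\<^sup>2"
        using pos by (simp add: power2_sum)
      also have "c * (real i + 1) + c * (real j + 1) + c * (real k + 1) = urn n"
        unfolding c[symmetric] n by (simp add: algebra_simps)
      finally have "l * ((c * (real i + 1))\<^sup>2 + (c * (real j + 1))\<^sup>2 + (c * (real k + 1))\<^sup>2) \<le> l * (urn n)\<^sup>2"
        using l by (intro mult_left_mono) auto
      then show "2 * (c * (real i + 1) * (F i j k - F (Suc i) j k))
        + 2 * (c * (real j + 1) * (F i j k - F i (Suc j) k))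
        + 2 * (c * (real k + 1) * (F i j k - F i j (Suc k)))
        \<le> l * (urn n)\<^sup>2 + ((F (Suc i) j k - F i j k)\<^sup>2 + (F i (Suc j) k - F i j k)\<^sup>2 + (F i j (Suc k) - F i j k)\<^sup>2) / l"
        using young[of "c * (real i + 1)" "F i j k - F (Suc i) j k"]
          young[of "c * (real j + 1)" "F i j k - F i (Suc j) k"]
          young[of "c * (real k + 1)" "F i j k - F i j (Suc k)"]
        unfolding power2_commute[of "F (Suc i) j k"] power2_commute[of "F i (Suc j) k"]
          power2_commute[of "F i j (Suc k)"] add_divide_distrib distrib_left
        by linarith
    qed
    also have "\<dots> = (\<Sum>p\<in>states n. l * (urn n)\<^sup>2) + ?E n / l"
      unfolding sum_divide_distrib sum.distrib[symmetric] by (rule sum.cong) auto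
    also have "(\<Sum>p\<in>states n. l * (urn n)\<^sup>2) = l * urn n * (urn n * real (card (states n)))"
      by (simp add: power2_eq_square)
    finally show ?thesis unfolding urn_card_states by simp
  qed
  have "F 0 0 0 = A 0"
  proof -
    have "states 0 = {(0, 0, 0)}" by (auto simp: states_def)
    then show ?thesis by (simp add: A_def urn_def)
  qed
  moreover have "A N = 0"
    unfolding A_def by (simp add: sum.neutral states_def zero case_prod_unfold)
  ultimately have "2 * F 0 0 0 = (\<Sum>n<N. 2 * (A n - A (Suc n)))"
    by (simp only: sum_distrib_left[symmetric] sum_lessThan_telescope' diff_zero)
  also have "\<dots> \<le> (\<Sum>n<N. l * urn n + ?E n / l)"
    by (intro sum_mono step)
  also have "\<dots> = l * (\<Sum>n<N. urn n) + (\<Sum>n<N. ?E n) / l"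
    by (simp add: sum.distrib sum_distrib_left sum_divide_distrib)
  also have "\<dots> \<le> 2 * l + (\<Sum>n<N. ?E n) / l"
    using mult_left_mono[OF sum_urn_le[of N], of l] l by simp
  finally show ?thesis .
qed

section \<open>Transfer of the flow bound to the lattice and summability\<close>

definition octant :: "nat \<times> nat \<times> nat \<Rightarrow> nat \<Rightarrow> int" where
  "octant = (\<lambda>(i, j, k). origin(0 := int i, 1 := int j, 2 := int k))"

lemma octant_up:
  "octant (Suc i, j, k) = up 0 (octant (i, j, k))"
  "octant (i, Suc j, k) = up 1 (octant (i, j, k))"
  "octant (i, j, Suc k) = up 2 (octant (i, j, k))"
  by (auto simp: octant_def up_def fun_eq_iff)

lemma inj_octant: "inj octant"
proof (rule injI)
  fix p q assume "octant p = octant q"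
  then have "octant p 0 = octant q 0" "octant p 1 = octant q 1" "octant p 2 = octant q 2" by auto
  then show "p = q" by (auto simp: octant_def split: prod.splits)
qed

text \<open>The injective embedding counts every edge of the octant at most once, and the remaining
  edges only add energy. \<open>N\<close> is chosen beyond all levels that meet the support of
  \<open>f\<close>.\<close>

lemma origin_value_le_energy:
  assumes f: "finsupp f" and l: "0 < l"
  shows "2 * f origin \<le> 2 * l + (\<Sum>i<3. \<Sum>\<^sub>\<infinity>x. (f (up i x) - f x)\<^sup>2) / l"
proof -
  let ?F = "\<lambda>i j k. f (octant (i, j, k))"
  have "finite (octant -` {x. f x \<noteq> 0})"
    using f inj_octant unfolding finsupp_def by (rule finite_vimageI)
  then have "finite ((\<lambda>(i, j, k). i + j + k) ` (octant -` {x. f x \<noteq> 0}))" by (rule finite_imageI)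
  then obtain N where N: "\<forall>n \<in> (\<lambda>(i, j, k). i + j + k) ` (octant -` {x. f x \<noteq> 0}). n < N"
    unfolding finite_nat_set_iff_bounded by blast
  have zero: "?F i j k = 0" if "i + j + k \<ge> N" for i j k
    using N that by (force simp: not_less[symmetric])
  let ?g = "\<lambda>i x. (f (up i x) - f x)\<^sup>2"
  have summ: "?g i summable_on UNIV" for i
    unfolding power2_eq_square by (intro finsupp_summable finsupp_mult_right finsupp_diff finsupp_up f)
  have "(\<Sum>n<N. \<Sum>p\<in>states n. ?g i (octant p)) \<le> (\<Sum>\<^sub>\<infinity>x. ?g i x)" for i
  proof -
    have "(\<Sum>n<N. \<Sum>p\<in>states n. ?g i (octant p)) = (\<Sum>p\<in>(\<Union>n<N. states n). ?g i (octant p))"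
      by (rule sum.UNION_disjoint[symmetric]) (simp, simp add: finite_states, auto simp: states_def)
    also have "\<dots> = (\<Sum>x\<in>octant ` (\<Union>n<N. states n). ?g i x)"
      by (rule sum.reindex_cong[symmetric, where l = octant]) (auto intro: inj_on_subset[OF inj_octant])
    also have "\<dots> \<le> (\<Sum>\<^sub>\<infinity>x. ?g i x)"
      by (rule finite_sum_le_infsum[OF summ]) (auto simp: finite_states)
    finally show ?thesis .
  qed
  then have "(\<Sum>i<3. \<Sum>n<N. \<Sum>p\<in>states n. ?g i (octant p)) \<le> (\<Sum>i<3. \<Sum>\<^sub>\<infinity>x. ?g i x)"
    by (intro sum_mono)
  moreover have "(\<Sum>n<N. \<Sum>(i, j, k)\<in>states n.
      (?F (Suc i) j k - ?F i j k)\<^sup>2 + (?F i (Suc j) k - ?F i j k)\<^sup>2 + (?F i j (Suc k) - ?F i j k)\<^sup>2)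
      = (\<Sum>i<3. \<Sum>n<N. \<Sum>p\<in>states n. ?g i (octant p))"
    by (simp add: octant_up eval_nat_numeral sum.distrib case_prod_unfold)
  ultimately have "(\<Sum>n<N. \<Sum>(i, j, k)\<in>states n.
      (?F (Suc i) j k - ?F i j k)\<^sup>2 + (?F i (Suc j) k - ?F i j k)\<^sup>2 + (?F i j (Suc k) - ?F i j k)\<^sup>2) / l
      \<le> (\<Sum>i<3. \<Sum>\<^sub>\<infinity>x. ?g i x) / l"
    using l by (intro divide_right_mono) auto
  moreover have "octant (0, 0, 0) = origin" by (auto simp: octant_def origin_def)
  ultimately show ?thesis
    using urn_energy_bound[where F = ?F and N = N, OF l zero] by simp
qed

lemma (in reversible_walk) summable_heat:
  assumes "3 \<le> d" "0 < \<kappa>" and cond: "\<And>i x. i < 3 \<Longrightarrow> \<kappa> \<le> w x * a i (x i)"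
  shows "summable (\<lambda>n. heat n origin)"
proof (rule summableI_nonneg_bounded)
  fix N
  \<comment> \<open>With this \<open>l\<close> the energy of \<open>green N\<close> divided by
    \<open>l\<close> is at most its value at the origin. That leaves \<open>2 * l\<close> plus the
    value as a bound for twice the value, so one copy is absorbed.\<close>
  define l where "l = w origin / \<kappa>"
  have l: "0 < l" using w_pos[of origin] assms(2) by (simp add: l_def)
  let ?f = "green N"
  have fd: "finsupp (\<lambda>x. ?f (up i x) - ?f x)" for i by (intro finsupp_diff finsupp_up finsupp_green)
  have "\<kappa> * (\<Sum>i<3. \<Sum>\<^sub>\<infinity>x. (?f (up i x) - ?f x)\<^sup>2)
      \<le> (\<Sum>i<3. \<Sum>\<^sub>\<infinity>x. w x * a i (x i) * (?f (up i x) - ?f x) * (?f (up i x) - ?f x))"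
    unfolding sum_distrib_left infsum_cmult_right'[symmetric]
  proof (intro sum_mono infsum_mono)
    fix i :: nat and x assume "i \<in> {..<3}"
    then have "\<kappa> \<le> w x * a i (x i)" using cond by simp
    then show "\<kappa> * (?f (up i x) - ?f x)\<^sup>2 \<le> w x * a i (x i) * (?f (up i x) - ?f x) * (?f (up i x) - ?f x)"
      using mult_right_mono[of \<kappa> "w x * a i (x i)" "(?f (up i x) - ?f x)\<^sup>2"]
      by (simp add: power2_eq_square mult.assoc)
  next
    fix i :: nat
    show "(\<lambda>x. w x * a i (x i) * (?f (up i x) - ?f x) * (?f (up i x) - ?f x)) summable_on UNIV"
      by (intro finsupp_summable finsupp_mult_right fd)
    show "(\<lambda>x. \<kappa> * (?f (up i x) - ?f x)\<^sup>2) summable_on UNIV"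
      unfolding power2_eq_square by (intro finsupp_summable finsupp_mult_right fd)
  qed
  also have "\<dots> \<le> form ?f ?f"
    unfolding form_def using assms(1)
    by (intro sum_mono2 infsum_nonneg form_self_term_nonneg) auto
  also have "\<dots> \<le> w origin * ?f origin" by (rule form_green_le)
  finally have "(\<Sum>i<3. \<Sum>\<^sub>\<infinity>x. (?f (up i x) - ?f x)\<^sup>2) / l \<le> ?f origin"
    using assms(2) w_pos[of origin] by (simp add: l_def field_simps)
  then have "?f origin \<le> 2 * l"
    using origin_value_le_energy[OF finsupp_green l, of N] by linarith
  then show "(\<Sum>n<N. heat n origin) \<le> 2 * (w origin / \<kappa>)"
    by (simp add: green_def l_def)
qed (rule heat_nonneg)

subsection \<open>The reversing measure\<close>

text \<open>Solving detailed balance outward from 0 gives this product on the nonnegative integers;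
  the formula extends it evenly, as the reflection symmetry of the rates permits.\<close>

definition weight1 :: "(int \<Rightarrow> real) \<Rightarrow> (int \<Rightarrow> real) \<Rightarrow> int \<Rightarrow> real" where
  "weight1 p q z = (\<Prod>k<nat \<bar>z\<bar>. p (int k) / q (int k + 1))"

lemma weight1_balance:
  assumes pos: "\<And>z. 0 < p z" "\<And>z. 0 < q z" and sym: "\<And>z. p z = q (- z)"
  shows "weight1 p q z * p z = weight1 p q (z + 1) * q (z + 1)"
proof (cases "0 \<le> z")
  case True
  then have "nat \<bar>z + 1\<bar> = Suc (nat \<bar>z\<bar>)" by simp
  then have "weight1 p q (z + 1) = weight1 p q z * (p z / q (z + 1))"
    using True by (simp add: weight1_def)
  then show ?thesis using pos(2)[of "z + 1"] by simp
next
  case False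
  \<comment> \<open>The edge between \<open>z\<close> and \<open>z + 1\<close> is the mirror image
    of the edge between \<open>m + 1\<close> and \<open>m\<close>, so its rates are those of the
    reflected edge with the roles of \<open>p\<close> and \<open>q\<close> exchanged.\<close>
  define m where "m = nat \<bar>z + 1\<bar>"
  have z: "z = - int m - 1" and m: "nat \<bar>z\<bar> = Suc m" using False by (auto simp: m_def)
  have "weight1 p q z = weight1 p q (z + 1) * (p (int m) / q (int m + 1))"
    by (simp add: weight1_def m flip: m_def)
  moreover have "p z = q (int m + 1)" "q (z + 1) = p (int m)"
    using sym[of z] sym[of "int m"] by (auto simp: z add.commute)
  ultimately show ?thesis using pos(2)[of "int m + 1"] by simp
qed

text \<open>Factors with index above \<open>K\<close> equal 1, because numerator and denominator
  both take the common outer rate. At most \<open>Suc K\<close> factors remain, each between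
  \<open>c\<close> and \<open>1 / c\<close>.\<close>

lemma weight1_bounds:
  assumes c: "0 < c" "c \<le> 1" and ge: "\<And>z. c \<le> p z" "\<And>z. c \<le> q z" and le: "\<And>z. p z \<le> 1" "\<And>z. q z \<le> 1"
    and eq: "\<And>z. int K < z \<Longrightarrow> p z = q z \<and> q z = q (z + 1)"
  shows "c ^ Suc K \<le> weight1 p q z" "weight1 p q z \<le> (1 / c) ^ Suc K"
proof -
  let ?r = "\<lambda>k. p (int k) / q (int k + 1)"
  let ?A = "{..<nat \<bar>z\<bar>} \<inter> {..K}"
  have qpos: "0 < q z" for z using c(1) ge(2)[of z] by linarith
  have "weight1 p q z = (\<Prod>k\<in>?A. ?r k)"
    unfolding weight1_def
  proof (rule prod.mono_neutral_right)
    show "\<forall>k\<in>{..<nat \<bar>z\<bar>} - ?A. ?r k = 1"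
      using eq qpos by (auto simp: not_le) (metis of_nat_less_iff less_irrefl)
  qed auto
  moreover have r: "c \<le> ?r k" "?r k \<le> 1 / c" for k
  proof -
    have "c * q (int k + 1) \<le> c * 1" using c le(2) by (intro mult_left_mono) auto
    then have "c * q (int k + 1) \<le> p (int k)" using ge(1)[of "int k"] by linarith
    then show "c \<le> ?r k" using qpos[of "int k + 1"] by (simp add: field_simps)
    have "p (int k) * c \<le> 1 * q (int k + 1)" using c ge le by (intro mult_mono) auto
    then show "?r k \<le> 1 / c" using qpos[of "int k + 1"] c by (simp add: field_simps)
  qed
  moreover have "card ?A \<le> Suc K" using card_mono[of "{..K}" ?A] by simp
  ultimately show "c ^ Suc K \<le> weight1 p q z" "weight1 p q z \<le> (1 / c) ^ Suc K"
  proof -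
    assume w: "weight1 p q z = (\<Prod>k\<in>?A. ?r k)" and card: "card ?A \<le> Suc K"
    have "c ^ Suc K \<le> c ^ card ?A" using c card by (intro power_decreasing) auto
    also have "\<dots> = (\<Prod>k\<in>?A. c)" by simp
    also have "\<dots> \<le> (\<Prod>k\<in>?A. ?r k)" using c r by (intro prod_mono) auto
    finally show "c ^ Suc K \<le> weight1 p q z" using w by simp
    have "(\<Prod>k\<in>?A. ?r k) \<le> (\<Prod>k\<in>?A. 1 / c)"
      using c r(2) order.trans[OF less_imp_le[OF c(1)] r(1)] by (intro prod_mono) auto
    also have "\<dots> = (1 / c) ^ card ?A" by simp
    also have "\<dots> \<le> (1 / c) ^ Suc K" using c card by (intro power_increasing) auto
    finally show "weight1 p q z \<le> (1 / c) ^ Suc K" using w by simp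
  qed
qed

theorem theorem4p7:
  fixes d :: nat and alpha :: "nat \<Rightarrow> real" and c :: real and Mb :: nat
    and a b :: "nat \<Rightarrow> int \<Rightarrow> real"
    and M :: "'w measure" and S :: "nat \<Rightarrow> 'w \<Rightarrow> (nat \<Rightarrow> int)"
  assumes "d \<ge> 1"
    and "\<And>i. i < d \<Longrightarrow> alpha i > 0"
    and "2 * (\<Sum>i<d. alpha i) = 1"
    and "0 < c" and "\<And>i. i < d \<Longrightarrow> c < alpha i"
    and "\<And>i x. i < d \<Longrightarrow> a i x \<ge> c \<and> b i x \<ge> c"
    and "\<And>i x. i < d \<Longrightarrow> a i x + b i x \<le> 2 * alpha i"
    and "\<And>i x. i < d \<Longrightarrow> a i x = b i (- x)"
    and "\<And>i x. i < d \<Longrightarrow> \<bar>x\<bar> > int Mb \<Longrightarrow> a i x = alpha i \<and> b i x = alpha i"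
    and "is_walk M S d a b"
  shows "(d \<le> 2 \<longrightarrow> recurrent M S) \<and> (d \<ge> 3 \<longrightarrow> transient M S)"
proof -
  have pos: "0 < a i z" "0 < b i z" if "i < d" for i z
    using assms(6)[OF that, of z] assms(4) by auto
  have total: "(\<Sum>i<d. a i (x i) + b i (x i)) \<le> 1" for x
  proof -
    have "(\<Sum>i<d. a i (x i) + b i (x i)) \<le> (\<Sum>i<d. 2 * alpha i)"
      using assms(7) by (intro sum_mono) auto
    then show ?thesis using assms(3) by (simp add: sum_distrib_left)
  qed
  have le1: "a i z \<le> 1" "b i z \<le> 1" if "i < d" for i z
  proof -
    have "a i z + b i z \<le> (\<Sum>i<d. a i z + b i z)"
      using that pos by (intro member_le_sum) (auto simp: less_imp_le add_nonneg_nonneg)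
    then have "a i z + b i z \<le> 1" using total[of "\<lambda>_. z"] by simp
    then show "a i z \<le> 1" "b i z \<le> 1" using pos[OF that, of z] by linarith+
  qed
  have c1: "c \<le> 1" using assms(1) assms(6)[of 0 0] le1[of 0 0] by fastforce
  define w where "w x = (\<Prod>i<d. weight1 (a i) (b i) (x i))" for x
  have eq: "a i z = b i z \<and> b i z = b i (z + 1)" if "i < d" "int Mb < z" for i z
    using assms(9)[OF that(1), of z] assms(9)[OF that(1), of "z + 1"] that(2) by simp
  have w1: "c ^ Suc Mb \<le> weight1 (a i) (b i) z" "weight1 (a i) (b i) z \<le> (1 / c) ^ Suc Mb"
    if "i < d" for i z
    by (rule weight1_bounds[OF assms(4) c1]; use that assms(6) le1 eq in blast)+
  have w1_pos: "0 < weight1 (a i) (b i) z" if "i < d" for i z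
    using w1(1)[OF that, of z] assms(4) by (meson less_le_trans zero_less_power)
  have w_lower: "(c ^ Suc Mb) ^ d \<le> w x" for x
  proof -
    have "(\<Prod>i<d. c ^ Suc Mb) \<le> w x"
      unfolding w_def using w1(1) assms(4) by (intro prod_mono) auto
    then show ?thesis by simp
  qed
  have w_upper: "w x \<le> ((1 / c) ^ Suc Mb) ^ d" for x
  proof -
    have "w x \<le> (\<Prod>i<d. (1 / c) ^ Suc Mb)"
      unfolding w_def using w1(2) w1_pos by (intro prod_mono) (auto simp: less_imp_le)
    then show ?thesis by simp
  qed
  have kernel: "walk_kernel d a b"
    using pos total by unfold_locales (auto simp: less_imp_le)
  interpret reversible_walk d a b w
  proof (intro reversible_walk.intro kernel reversible_walk_axioms.intro)
    show "0 < w x" for x unfolding w_def using w1_pos by (intro prod_pos) auto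
    show "w x * a i (x i) = w (up i x) * b i (x i + 1)" if i: "i < d" for i x
    proof -
      \<comment> \<open>A step in direction \<open>i\<close> changes only the \<open>i\<close>-th
        factor of the product, which reduces detailed balance to one dimension.\<close>
      let ?R = "\<Prod>j\<in>{..<d} - {i}. weight1 (a j) (b j) (x j)"
      have "w x = ?R * weight1 (a i) (b i) (x i)"
        unfolding w_def using i by (subst prod.remove[of _ i]) auto
      moreover have "w (up i x) = ?R * weight1 (a i) (b i) (x i + 1)"
        unfolding w_def using i by (subst prod.remove[of _ i]) (auto simp: up_def intro!: prod.cong)
      moreover have "weight1 (a i) (b i) (x i) * a i (x i) = weight1 (a i) (b i) (x i + 1) * b i (x i + 1)"
        using pos[OF i] assms(8)[OF i] by (rule weight1_balance)
      ultimately show ?thesis by (simp only: mult.assoc)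
    qed
  qed
  interpret prob_space M using assms(10) by (simp add: is_walk_def)
  interpret walk d a b M S by unfold_locales (rule assms(10))
  show ?thesis
  proof (intro conjI impI)
    assume "d \<le> 2"
    then show "recurrent M S"
      by (intro recurrent_if_not_summable not_summable_if_zero_capacity
          zero_capacity_plane[OF _ w_upper le1(1)])
  next
    assume "3 \<le> d"
    \<comment> \<open>A uniform lower bound for the conductances: the lower bound of
      \<open>w\<close> times the lower bound \<open>c\<close> of the rates.\<close>
    moreover have "0 < (c ^ Suc Mb) ^ d * c" using assms(4) by simp
    moreover have "(c ^ Suc Mb) ^ d * c \<le> w x * a i (x i)" if "i < 3" for i x
      using w_lower[of x] assms(4) assms(6)[of i "x i"] that \<open>3 \<le> d\<close>
      by (intro mult_mono) (auto intro: order.trans[OF _ w_lower])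
    ultimately show "transient M S"
      by (intro transient_if_summable summable_heat)
  qed
qed

end
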